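(* For any confidence level $\delta\in(0,1)$, $$\rho_{\mathcal{U}_c^*,\delta}(X)=\rho_{\hat u_{\rm MLE},\delta}(X)=\mathbb{E}_{\mathbb{P}_X}[\hat u_{\rm MLE}(X)]+F_\varepsilon^{-1}(\delta)\qquad\text{for all }X\in\mathcal{L}^p(\Omega,\mathcal{F},\mathbb{P};[0,\bar b]).$$ Moreover, for any $\delta\in(0,1)$, the following two problems share the same set of optimal solutions: $$\max_{x\in\mathcal{X}}\ \rho_{\mathcal{U}_c^*,\delta}\big(x^\top(\mathbf{1}+\xi)\big)\qquad\text{and}\qquad\max_{x\in\mathcal{X}}\ \mathbb{E}_{\mathbb{P}_\xi}\big[\hat u_{\rm MLE}(x^\top(\mathbf{1}+\xi))\big].$$
   Context: Fix $\bar b>0$, $L>0$, $\bar c>0$ and a probability space $(\Omega,\mathcal{F},\mathbb{P})$. $\mathcal{L}^p(\Omega,\mathcal{F},\mathbb{P};[0,\bar b])$ is the set of $[0,\bar b]$-valued random variables (with finite $p$-th moment). $\mathscr{U}$ is the set of integrable functions $u:[0,\bar b]\to[0,1]$. The response error $\varepsilon$ is $\mathrm{Gumbel}(0,\sigma)$ distributed, $\sigma>0$, with CDF $F_\varepsilon(x)=e^{-e^{-x/\sigma}}$, independent of the lotteries. For $u\in\mathscr{U}$ the Preference-at-Risk is $$\rho_{u,\delta}(X):=\max\{\eta\in\mathbb{R}:\ \mathbb{P}_\varepsilon(\mathbb{E}_{\mathbb{P}_X}[u(X)]+\varepsilon\ge\eta)\ge1-\delta\},$$ and for $\mathcal{U}\subseteq\mathscr{U}$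 the Preference-Robust-at-Risk is $$\rho_{\mathcal{U},\delta}(X):=\max\{\eta\in\mathbb{R}:\ \mathbb{P}_\varepsilon(\mathbb{E}_{\mathbb{P}_X}[u(X)]+\varepsilon\ge\eta)\ge1-\delta\ \ \forall u\in\mathcal{U}\}.$$ Portfolios: $\xi=(\xi_0,\xi_1,\dots,\xi_S)^\top$ is a random vector of return rates with $\xi_0=0$; $\mathcal{X}=\{x\in\mathbb{R}^{S+1}:\sum_{s=0}^Sx_s=W_0,\ 0\le x_0\le W_0,\ 0\le x_s\le c_sW_0,\ s=1,\dots,S\}$ with $W_0\in[0,\bar b]$, $c_s\in[0,1]$; the wealth $x^\top(\mathbf{1}+\xi)$ is assumed to take values in $[0,\bar b]$ for all $x\in\mathcal{X}$ ($\mathbf{1}$ the all-ones vector). $\mathcal{U}_c$ is the set of all functions $u:[0,\bar b]\to\mathbb{R}$ that are monotonically increasing (in the weak sense, i.e. nondecreasing), concave, Lipschitz continuous with modulus at most $L$, and satisfy $u(0)=0$, $u(\bar b)=1$. MLE-based utility $\hat u_{\rm MLE}$: given data $(W_k,Y_k,Z_k)$, $k=1,\dots,K$, with $W_k,Y_k$ lotteries with finite support in $[0,\bar b]$ and $Z_k\in\{1,-1\}$, let $\{y_1<\dots<y_N\}$ be the ordered union of $\{0,\bar b\}$ and all the supports, and $p^k_j=\mathbb{P}[W_k=y_j]-\mathbb{P}[Y_k=y_j]$. Let $(\bar\alpha^*,\bar\beta^*,\gamma^* )$ maximize $-\sum_{k}\log\big[1+\exp\big(\sum_{j=1}^N -Z_kp^k_j\bar\alpha_j\big)\big]$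 over $\bar\alpha\in\mathbb{R}^N$, $\bar\beta\in\mathbb{R}^{N-1}$, $\gamma\in[0,\bar c]$ subject to $\bar\beta_j=(\bar\alpha_{j+1}-\bar\alpha_j)/(y_{j+1}-y_j)$, $\bar\beta_{j+1}\le\bar\beta_j$, $\bar\beta_1\le L\gamma$, $\bar\beta_{N-1}\ge0$, $\bar\alpha_1=0$, $\bar\alpha_N=\gamma$; assume $\gamma^*>0$ (needed for $\hat u_{\rm MLE}$ to be defined). Then $\hat u_{\rm MLE}:[0,\bar b]\to[0,1]$ is the continuous function that is affine on each $[y_j,y_{j+1}]$ with $\hat u_{\rm MLE}(y_j)=\bar\alpha^*_j/\gamma^*$. Finally $\mathcal{U}_c^*:=\{u\in\mathcal{U}_c:\ u(y_j)=\hat u_{\rm MLE}(y_j),\ j=1,\dots,N\}$. *)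

theory Defs
  imports "HOL-Probability.Probability"
begin

definition Lp_lotteries :: "'w measure \<Rightarrow> real \<Rightarrow> real \<Rightarrow> ('w \<Rightarrow> real) set" where
  "Lp_lotteries M p b =
     {X \<in> borel_measurable M.
        (\<forall>\<omega>\<in>space M. X \<omega> \<in> {0..b}) \<and> integrable M (\<lambda>\<omega>. \<bar>X \<omega>\<bar> powr p)}"

text \<open>
  The response error is a random variable \<open>\<epsilon>\<close> on a probability space \<open>E\<close> of its own; its
  independence of the lotteries, which live on \<open>M\<close>, holds by construction.
  A utility on \<open>[0, b]\<close> is a total function whose values outside \<open>[0, b]\<close> are irrelevant.  The
  expected utility is therefore an integral over \<open>M\<close>: an integral over \<open>distr M borel X\<close> would
  require measurability of \<open>u\<close> on the whole line.
\<close>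

definition PaR ::
  "'w measure \<Rightarrow> 'e measure \<Rightarrow> ('e \<Rightarrow> real) \<Rightarrow> (real \<Rightarrow> real) \<Rightarrow> real \<Rightarrow> ('w \<Rightarrow> real) \<Rightarrow> real" where
  "PaR M E \<epsilon> u \<delta> X =
     (GREATEST \<eta>. measure E {e \<in> space E. (\<integral>\<omega>. u (X \<omega>) \<partial>M) + \<epsilon> e \<ge> \<eta>} \<ge> 1 - \<delta>)"

definition PRaR ::
  "'w measure \<Rightarrow> 'e measure \<Rightarrow> ('e \<Rightarrow> real) \<Rightarrow> (real \<Rightarrow> real) set \<Rightarrow> real \<Rightarrow> ('w \<Rightarrow> real) \<Rightarrow> real" where
  "PRaR M E \<epsilon> U \<delta> X =
     (GREATEST \<eta>. \<forall>u\<in>U. measure E {e \<in> space E. (\<integral>\<omega>. u (X \<omega>) \<partial>M) + \<epsilon> e \<ge> \<eta>} \<ge> 1 - \<delta>)"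

definition concave_utilities :: "real \<Rightarrow> real \<Rightarrow> (real \<Rightarrow> real) set" where
  "concave_utilities b L =
     {u. mono_on {0..b} u \<and> concave_on {0..b} u \<and> L-lipschitz_on {0..b} u \<and> u 0 = 0 \<and> u b = 1}"

text \<open>
  Vectors indexed by \<open>1, \<dots>, N\<close> (or \<open>1, \<dots>, N - 1\<close>) are functions on \<open>nat\<close>, of which only the
  values at these indices are used.
\<close>

definition MLE_feasible ::
  "real \<Rightarrow> real \<Rightarrow> nat \<Rightarrow> (nat \<Rightarrow> real) \<Rightarrow> (nat \<Rightarrow> real) \<times> (nat \<Rightarrow> real) \<times> real \<Rightarrow> bool" where
  "MLE_feasible L c N y = (\<lambda>(\<alpha>, \<beta>, \<gamma>).
     \<gamma> \<in> {0..c} \<and>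
     (\<forall>j\<in>{1..N - 1}. \<beta> j = (\<alpha> (j + 1) - \<alpha> j) / (y (j + 1) - y j)) \<and>
     (\<forall>j\<in>{1..N - 2}. \<beta> (j + 1) \<le> \<beta> j) \<and>
     \<beta> 1 \<le> L * \<gamma> \<and> \<beta> (N - 1) \<ge> 0 \<and> \<alpha> 1 = 0 \<and> \<alpha> N = \<gamma>)"

definition MLE_objective ::
  "nat \<Rightarrow> (nat \<Rightarrow> real pmf) \<Rightarrow> (nat \<Rightarrow> real pmf) \<Rightarrow> (nat \<Rightarrow> real) \<Rightarrow> nat \<Rightarrow> (nat \<Rightarrow> real)
     \<Rightarrow> (nat \<Rightarrow> real) \<times> (nat \<Rightarrow> real) \<times> real \<Rightarrow> real" where
  "MLE_objective K W Y Z N y = (\<lambda>(\<alpha>, \<beta>, \<gamma>).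
     - (\<Sum>k = 1..K. ln (1 + exp (\<Sum>j = 1..N. - Z k * (pmf (W k) (y j) - pmf (Y k) (y j)) * \<alpha> j))))"

definition pw_affine :: "nat \<Rightarrow> (nat \<Rightarrow> real) \<Rightarrow> (nat \<Rightarrow> real) \<Rightarrow> real \<Rightarrow> real" where
  "pw_affine N y v t =
     (let j = (GREATEST j. j \<in> {1..<N} \<and> y j \<le> t)
      in v j + (v (j + 1) - v j) / (y (j + 1) - y j) * (t - y j))"

lemma pw_affine_eq:
  assumes y: "strict_mono_on {1..N} y" and j: "j \<in> {1..<N}" and t: "t \<in> {y j..y (j + 1)}"
  shows "pw_affine N y v t = v j + (v (j + 1) - v j) / (y (j + 1) - y j) * (t - y j)"
proof (cases "t = y (j + 1) \<and> j + 1 < N")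
  case True
  have "(GREATEST i. i \<in> {1..<N} \<and> y i \<le> t) = j + 1"
  proof (rule Greatest_equality)
    show "j + 1 \<in> {1..<N} \<and> y (j + 1) \<le> t" using True by auto
    show "i \<le> j + 1" if "i \<in> {1..<N} \<and> y i \<le> t" for i
      using strict_mono_onD[OF y, of "j + 1" i] that True j by fastforce
  qed
  moreover have "y j < y (j + 1)" using strict_mono_onD[OF y, of j "j + 1"] j by auto
  ultimately show ?thesis using True by (simp add: pw_affine_def)
next
  case False
  have "(GREATEST i. i \<in> {1..<N} \<and> y i \<le> t) = j"
  proof (rule Greatest_equality)
    show "j \<in> {1..<N} \<and> y j \<le> t" using j t by auto
    show "i \<le> j" if i: "i \<in> {1..<N} \<and> y i \<le> t" for i
    proof (rule ccontr)
      assume "\<not> i \<le> j"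
      hence "j + 1 \<le> i" by simp
      hence "y (j + 1) \<le> y i"
        using strict_mono_onD[OF y, of "j + 1" i] i j by (cases "j + 1 = i") fastforce+
      thus False using False i t \<open>j + 1 \<le> i\<close> by auto
    qed
  qed
  thus ?thesis by (simp add: pw_affine_def)
qed

definition MLE_utility :: "nat \<Rightarrow> (nat \<Rightarrow> real) \<Rightarrow> (nat \<Rightarrow> real) \<Rightarrow> real \<Rightarrow> real \<Rightarrow> real" where
  "MLE_utility N y \<alpha> \<gamma> = pw_affine N y (\<lambda>j. \<alpha> j / \<gamma>)"

definition MLE_ambiguity_set ::
  "real \<Rightarrow> real \<Rightarrow> nat \<Rightarrow> (nat \<Rightarrow> real) \<Rightarrow> (real \<Rightarrow> real) \<Rightarrow> (real \<Rightarrow> real) set" where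
  "MLE_ambiguity_set b L N y u' =
     {u \<in> concave_utilities b L. \<forall>j\<in>{1..N}. u (y j) = u' (y j)}"

text \<open>Elements of \<open>\<real>\<^sup>S\<^sup>+\<^sup>1\<close> are functions on \<open>{0..S}\<close>, extended by \<open>undefined\<close>.\<close>

definition portfolios :: "nat \<Rightarrow> real \<Rightarrow> (nat \<Rightarrow> real) \<Rightarrow> (nat \<Rightarrow> real) set" where
  "portfolios S W0 c =
     {x \<in> {0..S} \<rightarrow>\<^sub>E UNIV.
        (\<Sum>s = 0..S. x s) = W0 \<and> 0 \<le> x 0 \<and> x 0 \<le> W0 \<and>
        (\<forall>s\<in>{1..S}. 0 \<le> x s \<and> x s \<le> c s * W0)}"

definition wealth :: "nat \<Rightarrow> (nat \<Rightarrow> 'w \<Rightarrow> real) \<Rightarrow> (nat \<Rightarrow> real) \<Rightarrow> 'w \<Rightarrow> real" where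
  "wealth S \<xi> x \<omega> = (\<Sum>s = 0..S. x s * (1 + \<xi> s \<omega>))"

end

theory Submission
  imports Defs
begin

text \<open>
  A piecewise affine function with decreasing slopes is, on its domain, the minimum of its affine
  pieces; hence \<open>u_MLE\<close> inherits concavity, monotonicity and the Lipschitz bound from the MLE
  constraints and belongs to the ambiguity set.  Concavity also makes it the least element of that
  set, so the worst case over the set is attained at \<open>u_MLE\<close> for every lottery.  The Gumbel CDF is
  continuous and strictly increasing, so the acceptance condition
  \<open>P(E[u(X)] + \<epsilon> \<ge> \<eta>) \<ge> 1 - \<delta>\<close> reads \<open>\<eta> \<le> E[u(X)] + F\<^sup>-\<^sup>1(\<delta>)\<close>; the two portfolio objectives
  then differ by a constant.
\<close>

section \<open>Piecewise affine interpolation of nodal values\<close>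

lemma pw_affine_node:
  assumes y: "strict_mono_on {1..N} y" and N: "N \<ge> 2" and j: "j \<in> {1..N}"
  shows "pw_affine N y v (y j) = v j"
proof (cases "j < N")
  case True
  then have "y j < y (j + 1)" using strict_mono_onD[OF y, of j "j + 1"] j by auto
  then show ?thesis using pw_affine_eq[OF y, of j "y j" v] True j by auto
next
  case False
  then have "j = N" using j by simp
  \<comment> \<open>No piece starts at the last node, so its value is read off as the right end of
    piece \<open>N - 1\<close>.\<close>
  define i where "i = N - 1"
  have i: "i \<in> {1..<N}" "N = i + 1" using N by (auto simp: i_def)
  have "y i < y (i + 1)" using strict_mono_onD[OF y, of i "i + 1"] i by auto
  then show ?thesis
    using pw_affine_eq[OF y i(1), of "y (i + 1)" v] \<open>j = N\<close> i(2) by auto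
qed

lemma node_interval_exists:
  fixes y :: "nat \<Rightarrow> real"
  assumes N: "N \<ge> 2" and t: "t \<in> {y 1..y N}"
  obtains j where "j \<in> {1..<N}" "t \<in> {y j..y (j + 1)}"
proof -
  define j where "j = (GREATEST j. j \<in> {1..<N} \<and> y j \<le> t)"
  have ex: "1 \<in> {1..<N} \<and> y 1 \<le> t" using N t by auto
  have bd: "\<And>i. i \<in> {1..<N} \<and> y i \<le> t \<Longrightarrow> i \<le> N" by auto
  have j: "j \<in> {1..<N} \<and> y j \<le> t" unfolding j_def
    by (rule GreatestI_nat[where b = N and P = "\<lambda>j. j \<in> {1..<N} \<and> y j \<le> t"]) (use ex bd in auto)
  have "t \<le> y (j + 1)"
  proof (rule ccontr)
    assume "\<not> t \<le> y (j + 1)"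
    moreover from this have "j + 1 \<noteq> N" using t by auto
    ultimately have "j + 1 \<in> {1..<N} \<and> y (j + 1) \<le> t" using j by auto
    then have "j + 1 \<le> j" unfolding j_def
      by (rule Greatest_le_nat[where b = N and P = "\<lambda>j. j \<in> {1..<N} \<and> y j \<le> t"]) (use bd in auto)
    then show False by simp
  qed
  with j that show thesis by auto
qed

text \<open>Neighbouring pieces agree at their common node, so at \<open>t\<close> they differ by
  the change of slope times the signed distance of \<open>t\<close> from that node. As slopes
  decrease, walking away from the piece over \<open>t\<close> in either direction can only raise the
  value at \<open>t\<close>.\<close>

lemma pw_affine_le_piece:
  assumes y: "strict_mono_on {1..N} y" and i: "i \<in> {1..<N}" and t: "t \<in> {y i..y (i + 1)}"
    and j: "j \<in> {1..<N}"
    and dec: "\<And>k. k \<in> {1..N - 2} \<Longrightarrow>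
      (v (k + 2) - v (k + 1)) / (y (k + 2) - y (k + 1)) \<le> (v (k + 1) - v k) / (y (k + 1) - y k)"
  shows "pw_affine N y v t \<le> v j + (v (j + 1) - v j) / (y (j + 1) - y j) * (t - y j)"
proof -
  define s where "s k = (v (k + 1) - v k) / (y (k + 1) - y k)" for k
  define A where "A k = v k + s k * (t - y k)" for k
  have mono: "y k \<le> y l" if "k \<in> {1..N}" "l \<in> {1..N}" "k \<le> l" for k l
    using strict_mono_onD[OF y, of k l] that by (cases "k = l") auto
  have piece_diff: "A (Suc k) - A k = (s (Suc k) - s k) * (t - y (Suc k))" if "k \<in> {1..<N}" for k
  proof -
    have "y k < y (Suc k)" using strict_mono_onD[OF y, of k "Suc k"] that by auto
    then have "s k * (y (Suc k) - y k) = v (Suc k) - v k" by (simp add: s_def)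
    then show ?thesis by (simp add: A_def algebra_simps)
  qed
  have s_dec: "s (Suc k) \<le> s k" if "k \<in> {1..N - 2}" for k
    using dec[OF that] by (simp add: s_def)
  have "A i \<le> A j"
  proof (cases "i \<le> j")
    case True
    \<comment> \<open>Going right, \<open>t\<close> lies left of every node crossed: slope change
      and distance are both nonpositive.\<close>
    then show ?thesis using j
    proof (induction j rule: dec_induct)
      case (step k)
      have "t \<le> y (Suc k)" using mono[of "i + 1" "Suc k"] step i t by auto
      moreover have "s (Suc k) \<le> s k" using s_dec step i by auto
      ultimately have "A k \<le> A (Suc k)"
        using \<open>k \<ge> i\<close> i step.prems piece_diff[of k]
          mult_nonpos_nonpos[of "s (Suc k) - s k" "t - y (Suc k)"] by auto
      with step i show ?case by auto
    qed simp
  next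
    case False
    then have "j \<le> i" by simp
    \<comment> \<open>Going left, by downward induction from \<open>i\<close>, \<open>t\<close> lies
      right of every node crossed, so the two factors have opposite signs.\<close>
    then show ?thesis using j
    proof (induction j rule: inc_induct)
      case (step k)
      have "y (Suc k) \<le> t" using mono[of "Suc k" i] step i t by auto
      moreover have "s (Suc k) \<le> s k" using s_dec step i by auto
      ultimately have "A (Suc k) \<le> A k"
        using step.prems piece_diff[of k]
          mult_nonpos_nonneg[of "s (Suc k) - s k" "t - y (Suc k)"] by auto
      with step i show ?case by auto
    qed simp
  qed
  moreover have "pw_affine N y v t = A i" using pw_affine_eq[OF y i t] by (simp add: A_def s_def)
  ultimately show ?thesis by (simp add: A_def s_def)
qed

text \<open>The slope of the piece over a point is a supergradient there and lies in
  \<open>{0..L}\<close>. Monotonicity, the Lipschitz bound and concavity all follow from such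
  supporting lines.\<close>

lemma pw_affine_in_concave_utilities:
  assumes y: "strict_mono_on {1..N} y" and N: "N \<ge> 2" and ends: "y 1 = 0" "y N = b"
    and v: "v 1 = 0" "v N = 1" and L: "0 \<le> L"
    and dec: "\<And>k. k \<in> {1..N - 2} \<Longrightarrow>
      (v (k + 2) - v (k + 1)) / (y (k + 2) - y (k + 1)) \<le> (v (k + 1) - v k) / (y (k + 1) - y k)"
    and slope: "\<And>k. k \<in> {1..<N} \<Longrightarrow> (v (k + 1) - v k) / (y (k + 1) - y k) \<in> {0..L}"
  shows "pw_affine N y v \<in> concave_utilities b L"
proof -
  let ?u = "pw_affine N y v"
  have supporting: "\<exists>s\<in>{0..L}. \<forall>r\<in>{0..b}. ?u r \<le> ?u t + s * (r - t)" if t: "t \<in> {0..b}" for t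
  proof -
    obtain i where i: "i \<in> {1..<N}" "t \<in> {y i..y (i + 1)}"
      using node_interval_exists[OF N, of t y] t ends by auto
    let ?s = "(v (i + 1) - v i) / (y (i + 1) - y i)"
    have "?u r \<le> ?u t + ?s * (r - t)" if r: "r \<in> {0..b}" for r
    proof -
      obtain k where k: "k \<in> {1..<N}" "r \<in> {y k..y (k + 1)}"
        using node_interval_exists[OF N, of r y] r ends by auto
      show ?thesis
        using pw_affine_le_piece[OF y k i(1) dec] pw_affine_eq[OF y i, of v]
        by (simp add: right_diff_distrib)
    qed
    then show ?thesis using slope[OF i(1)] by blast
  qed
  have diff: "0 \<le> ?u q - ?u p" "?u q - ?u p \<le> L * (q - p)"
    if pq: "p \<in> {0..b}" "q \<in> {0..b}" "p \<le> q" for p q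
  proof -
    \<comment> \<open>The supporting line at the right point \<open>q\<close> has nonnegative slope,
      hence bounds the value at \<open>p\<close> by that at \<open>q\<close>.\<close>
    obtain s where s: "s \<in> {0..L}" "\<forall>r\<in>{0..b}. ?u r \<le> ?u q + s * (r - q)"
      using supporting[OF pq(2)] by blast
    have "?u p \<le> ?u q + s * (p - q)" using s(2) pq(1) by blast
    moreover have "s * (p - q) \<le> 0" using s(1) pq(3) by (simp add: mult_nonneg_nonpos)
    ultimately show "0 \<le> ?u q - ?u p" by simp
    \<comment> \<open>The supporting line at the left point \<open>p\<close> has slope at most
      \<open>L\<close>, hence limits the growth up to \<open>q\<close>.\<close>
    obtain s' where s': "s' \<in> {0..L}" "\<forall>r\<in>{0..b}. ?u r \<le> ?u p + s' * (r - p)"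
      using supporting[OF pq(1)] by blast
    have "?u q \<le> ?u p + s' * (q - p)" using s'(2) pq(2) by blast
    moreover have "s' * (q - p) \<le> L * (q - p)" using s'(1) pq(3) by (simp add: mult_right_mono)
    ultimately show "?u q - ?u p \<le> L * (q - p)" by simp
  qed
  have "mono_on {0..b} ?u" using diff(1) by (intro mono_onI) fastforce
  moreover have "L-lipschitz_on {0..b} ?u"
  proof (rule lipschitz_on_leI)
    show "dist (?u p) (?u q) \<le> L * dist p q" if "p \<in> {0..b}" "q \<in> {0..b}" "p \<le> q" for p q
      using diff[OF that] that(3) by (simp add: dist_real_def abs_if)
  qed (rule L)
  moreover have "concave_on {0..b} ?u"
    unfolding concave_on_iff
  proof (intro conjI ballI allI impI)
    fix p q \<mu> \<nu> :: real
    assume A: "p \<in> {0..b}" "q \<in> {0..b}" "0 \<le> \<mu>" "0 \<le> \<nu>" "\<mu> + \<nu> = 1"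
    define t where "t = \<mu> *\<^sub>R p + \<nu> *\<^sub>R q"
    have "t \<in> {0..b}" unfolding t_def using convexD[of "{0..b}" p q \<mu> \<nu>] A by auto
    then obtain s where s: "\<forall>r\<in>{0..b}. ?u r \<le> ?u t + s * (r - t)"
      using supporting by blast
    \<comment> \<open>Jensen's argument: both values are bounded by the supporting line at the
      convex combination \<open>t\<close>, where the linear terms average out.\<close>
    have "\<mu> * ?u p + \<nu> * ?u q \<le> \<mu> * (?u t + s * (p - t)) + \<nu> * (?u t + s * (q - t))"
      using s A by (intro add_mono mult_left_mono) auto
    also have "\<dots> = (\<mu> + \<nu>) * (?u t - s * t) + s * (\<mu> * p + \<nu> * q)"
      by (simp add: algebra_simps)
    also have "\<dots> = ?u t" using A(5) by (simp add: t_def)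
    finally show "\<mu> * ?u p + \<nu> * ?u q \<le> ?u (\<mu> *\<^sub>R p + \<nu> *\<^sub>R q)" by (simp add: t_def)
  qed simp
  moreover have "?u 0 = 0" "?u b = 1"
    using pw_affine_node[OF y N, of 1 v] pw_affine_node[OF y N, of N v] N ends v by auto
  ultimately show ?thesis by (simp add: concave_utilities_def)
qed

text \<open>Between neighbouring nodes the interpolant is the chord of \<open>u\<close>, and a
  concave function lies above its chords.\<close>

lemma pw_affine_le_concave:
  assumes y: "strict_mono_on {1..N} y" and N: "N \<ge> 2" and t: "t \<in> {y 1..y N}"
    and u: "concave_on {y 1..y N} u" and eq: "\<And>j. j \<in> {1..N} \<Longrightarrow> u (y j) = v j"
  shows "pw_affine N y v t \<le> u t"
proof -
  obtain j where j: "j \<in> {1..<N}" "t \<in> {y j..y (j + 1)}"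
    using node_interval_exists[OF N t] by blast
  have mono: "y k \<le> y l" if "k \<in> {1..N}" "l \<in> {1..N}" "k \<le> l" for k l
    using strict_mono_onD[OF y, of k l] that by (cases "k = l") auto
  have "{y j..y (j + 1)} \<subseteq> {y 1..y N}" using mono[of 1 j] mono[of "j + 1" N] j by auto
  then have "concave_on {y j..y (j + 1)} u"
    using convex_on_subset[of "{y 1..y N}" "\<lambda>x. - u x" "{y j..y (j + 1)}"] u
    by (simp add: concave_on_def)
  from concave_onD_Icc'[OF this j(2)] show ?thesis
    using pw_affine_eq[OF y j, of v] eq[of j] eq[of "j + 1"] j by (simp add: algebra_simps)
qed

section \<open>The MLE-based utility as least element of its ambiguity set\<close>

lemma MLE_utility_in_ambiguity_set:
  assumes feas: "MLE_feasible L c N y (\<alpha>, \<beta>, \<gamma>)" and "\<gamma> > 0" and "L \<ge> 0"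
    and y: "strict_mono_on {1..N} y" and N: "N \<ge> 2" and ends: "y 1 = 0" "y N = b"
  shows "MLE_utility N y \<alpha> \<gamma> \<in> MLE_ambiguity_set b L N y (MLE_utility N y \<alpha> \<gamma>)"
proof -
  have \<beta>: "\<beta> j = (\<alpha> (j + 1) - \<alpha> j) / (y (j + 1) - y j)" if "j \<in> {1..N - 1}" for j
    using feas that by (simp add: MLE_feasible_def)
  have dec: "\<beta> (j + 1) \<le> \<beta> j" if "j \<in> {1..N - 2}" for j
    using feas that by (simp add: MLE_feasible_def)
  have bounds: "\<beta> 1 \<le> L * \<gamma>" "\<beta> (N - 1) \<ge> 0" and \<alpha>: "\<alpha> 1 = 0" "\<alpha> N = \<gamma>"
    using feas by (auto simp: MLE_feasible_def)
  \<comment> \<open>Only the first and the last slope are bounded directly; the chain of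
    inequalities carries these bounds to all slopes.\<close>
  have anti: "\<beta> l \<le> \<beta> k" if "k \<le> l" "1 \<le> k" "l \<le> N - 1" for k l
    using that
  proof (induction l rule: dec_induct)
    case (step l)
    then have "l \<in> {1..N - 2}" by auto
    from dec[OF this] step show ?case by auto
  qed simp
  \<comment> \<open>Dividing by \<gamma> normalises the utility: the slopes become \<beta> /
    \<gamma>, so the bound \<open>L * \<gamma>\<close> turns into \<open>L\<close>.\<close>
  have s: "(\<alpha> (j + 1) / \<gamma> - \<alpha> j / \<gamma>) / (y (j + 1) - y j) = \<beta> j / \<gamma>" if "j \<in> {1..N - 1}" for j
    using \<beta>[OF that] by (simp add: diff_divide_distrib[symmetric] divide_divide_eq_left mult.commute)
  have "pw_affine N y (\<lambda>j. \<alpha> j / \<gamma>) \<in> concave_utilities b L"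
  proof (rule pw_affine_in_concave_utilities[OF y N ends])
    show "(\<alpha> (k + 2) / \<gamma> - \<alpha> (k + 1) / \<gamma>) / (y (k + 2) - y (k + 1))
        \<le> (\<alpha> (k + 1) / \<gamma> - \<alpha> k / \<gamma>) / (y (k + 1) - y k)" if "k \<in> {1..N - 2}" for k
    proof -
      have "k \<in> {1..N - 1}" "k + 1 \<in> {1..N - 1}" using that by auto
      then show ?thesis using s[of k] s[of "k + 1"] dec[OF that] \<open>\<gamma> > 0\<close>
        by (simp add: divide_right_mono)
    qed
    show "(\<alpha> (k + 1) / \<gamma> - \<alpha> k / \<gamma>) / (y (k + 1) - y k) \<in> {0..L}" if "k \<in> {1..<N}" for k
    proof -
      have k: "k \<in> {1..N - 1}" using that by auto
      have "\<beta> k \<le> L * \<gamma>" "0 \<le> \<beta> k"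
        using anti[of 1 k] anti[of k "N - 1"] bounds k by auto
      then show ?thesis unfolding s[OF k] using \<open>\<gamma> > 0\<close> by (simp add: pos_divide_le_eq)
    qed
  qed (use \<alpha> \<open>\<gamma> > 0\<close> \<open>L \<ge> 0\<close> in auto)
  then show ?thesis by (simp add: MLE_ambiguity_set_def MLE_utility_def)
qed

lemma MLE_utility_le:
  assumes u: "u \<in> MLE_ambiguity_set b L N y (MLE_utility N y \<alpha> \<gamma>)"
    and y: "strict_mono_on {1..N} y" and N: "N \<ge> 2" and ends: "y 1 = 0" "y N = b"
    and t: "t \<in> {0..b}"
  shows "MLE_utility N y \<alpha> \<gamma> t \<le> u t"
  unfolding MLE_utility_def
proof (rule pw_affine_le_concave[OF y N])
  show "u (y j) = \<alpha> j / \<gamma>" if "j \<in> {1..N}" for j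
    using u that pw_affine_node[OF y N that]
    by (simp add: MLE_ambiguity_set_def MLE_utility_def)
qed (use u ends t in \<open>auto simp: MLE_ambiguity_set_def concave_utilities_def\<close>)

section \<open>Integrability of the utility of a lottery\<close>

lemma concave_utility_integrable:
  assumes "prob_space M" and u: "u \<in> concave_utilities b L" and X: "X \<in> Lp_lotteries M p b"
  shows "integrable M (\<lambda>\<omega>. u (X \<omega>))"
proof -
  interpret prob_space M by fact
  have X': "X \<in> borel_measurable M" "\<And>\<omega>. \<omega> \<in> space M \<Longrightarrow> X \<omega> \<in> {0..b}"
    using X by (auto simp: Lp_lotteries_def)
  have lip: "L-lipschitz_on {0..b} u" and mono: "mono_on {0..b} u" and ends: "u 0 = 0" "u b = 1"
    using u by (auto simp: concave_utilities_def)
  \<comment> \<open>Outside \<open>{0..b}\<close> the function \<open>u\<close> is arbitrary, so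
    measurability goes through the restricted Borel space.\<close>
  have "u \<in> borel_measurable (restrict_space borel {0..b})"
    by (intro borel_measurable_continuous_on_restrict lipschitz_on_continuous_on[OF lip])
  moreover have "X \<in> measurable M (restrict_space borel {0..b})"
    using X' by (intro measurable_restrict_space2) auto
  ultimately have "(\<lambda>\<omega>. u (X \<omega>)) \<in> borel_measurable M" by (rule measurable_compose[rotated])
  \<comment> \<open>Monotonicity and the normalisation at both ends confine \<open>u\<close> to
    [0, 1].\<close>
  moreover have "norm (u (X \<omega>)) \<le> 1" if "\<omega> \<in> space M" for \<omega>
    using mono_onD[OF mono, of 0 "X \<omega>"] mono_onD[OF mono, of "X \<omega>" b] X'(2)[OF that] ends by auto
  ultimately show ?thesis by (intro integrable_const_bound[where B = 1]) auto
qed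

section \<open>Preference-at-Risk as a quantile\<close>

text \<open>The condition says that \<epsilon> falls below \<open>\<eta> - m\<close> with
  probability at most \<delta>. Since the CDF is continuous, this probability is the CDF at
  \<open>\<eta> - m\<close>; since it is strictly increasing and takes the value \<delta> at
  \<open>q\<close>, it can be cancelled.\<close>

lemma survival_ge_iff:
  assumes "prob_space E" and \<epsilon>: "\<epsilon> \<in> borel_measurable E"
    and cont: "\<And>t. isCont (cdf (distr E borel \<epsilon>)) t"
    and mono: "strict_mono (cdf (distr E borel \<epsilon>))"
    and q: "cdf (distr E borel \<epsilon>) q = \<delta>"
  shows "measure E {e \<in> space E. m + \<epsilon> e \<ge> \<eta>} \<ge> 1 - \<delta> \<longleftrightarrow> \<eta> \<le> m + q"
proof -
  interpret prob_space E by fact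
  interpret D: real_distribution "distr E borel \<epsilon>" using \<epsilon> by simp
  let ?F = "cdf (distr E borel \<epsilon>)"
  \<comment> \<open>The left limit of a CDF is the mass of the open half-line; continuity equates it
    with the value, so there is no atom.\<close>
  have "(?F \<longlongrightarrow> ?F (\<eta> - m)) (at_left (\<eta> - m))"
    using cont[of "\<eta> - m"] by (simp add: isCont_def filterlim_at_split)
  then have "measure (distr E borel \<epsilon>) {..<\<eta> - m} = ?F (\<eta> - m)"
    using tendsto_unique[OF _ D.cdf_at_left] by simp
  then have "measure E {e \<in> space E. \<epsilon> e < \<eta> - m} = ?F (\<eta> - m)"
    using \<epsilon> by (simp add: measure_distr vimage_def Int_def conj_commute)
  moreover have "measure E {e \<in> space E. m + \<epsilon> e \<ge> \<eta>}
      = 1 - measure E {e \<in> space E. \<epsilon> e < \<eta> - m}"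
  proof -
    have "{e \<in> space E. m + \<epsilon> e \<ge> \<eta>} = space E - {e \<in> space E. \<epsilon> e < \<eta> - m}" by auto
    then show ?thesis using prob_compl[of "{e \<in> space E. \<epsilon> e < \<eta> - m}"] \<epsilon> by simp
  qed
  ultimately have "measure E {e \<in> space E. m + \<epsilon> e \<ge> \<eta>} \<ge> 1 - \<delta> \<longleftrightarrow> ?F (\<eta> - m) \<le> ?F q"
    using q by auto
  then show ?thesis using strict_mono_less_eq[OF mono] by auto
qed

text \<open>Each utility bounds \<eta> by its expectation plus \<open>q\<close>, so the constraint
  of the minimiser \<open>v\<close> is the binding one. Taking \<open>U\<close> to be a singleton
  covers the non-robust risk measure too.\<close>

lemma PRaR_eq:
  assumes "prob_space E" and "\<epsilon> \<in> borel_measurable E"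
    and "\<And>t. isCont (cdf (distr E borel \<epsilon>)) t"
    and "strict_mono (cdf (distr E borel \<epsilon>))"
    and "cdf (distr E borel \<epsilon>) q = \<delta>"
    and "v \<in> U" and "\<And>u. u \<in> U \<Longrightarrow> (\<integral>\<omega>. v (X \<omega>) \<partial>M) \<le> (\<integral>\<omega>. u (X \<omega>) \<partial>M)"
  shows "PRaR M E \<epsilon> U \<delta> X = (\<integral>\<omega>. v (X \<omega>) \<partial>M) + q"
  unfolding PRaR_def survival_ge_iff[OF assms(1-5)]
  using assms(6,7) by (intro Greatest_equality) force+

lemma PaR_eq_PRaR_singleton: "PaR M E \<epsilon> u \<delta> X = PRaR M E \<epsilon> {u} \<delta> X"
  by (simp add: PaR_def PRaR_def)

lemma strict_mono_gumbel:
  fixes \<sigma> :: real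
  assumes "\<sigma> > 0"
  shows "strict_mono (\<lambda>t. exp (- exp (- t / \<sigma>)))"
  using assms by (auto intro!: strict_monoI simp: divide_strict_right_mono)

lemma gumbel_quantile:
  fixes \<sigma> \<delta> :: real
  assumes "\<sigma> > 0" and "\<delta> \<in> {0<..<1}"
  shows "exp (- exp (- (- \<sigma> * ln (- ln \<delta>)) / \<sigma>)) = \<delta>"
  using assms by simp

section \<open>From lottery values to portfolio choice\<close>

lemma wealth_in_Lp_lotteries:
  assumes "prob_space M" and "p \<ge> 0" and \<xi>: "\<And>s. s \<in> {0..S} \<Longrightarrow> \<xi> s \<in> borel_measurable M"
    and range: "\<And>\<omega>. \<omega> \<in> space M \<Longrightarrow> wealth S \<xi> x \<omega> \<in> {0..b}"
  shows "wealth S \<xi> x \<in> Lp_lotteries M p b"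
proof -
  interpret prob_space M by fact
  have [measurable]: "wealth S \<xi> x \<in> borel_measurable M"
    unfolding wealth_def[abs_def] using \<xi>
    by (intro borel_measurable_sum borel_measurable_times borel_measurable_add) auto
  have "integrable M (\<lambda>\<omega>. \<bar>wealth S \<xi> x \<omega>\<bar> powr p)"
  proof (rule integrable_const_bound[where B = "b powr p"])
    show "AE \<omega> in M. norm (\<bar>wealth S \<xi> x \<omega>\<bar> powr p) \<le> b powr p"
    proof (rule AE_I2)
      fix \<omega> assume "\<omega> \<in> space M"
      from range[OF this] show "norm (\<bar>wealth S \<xi> x \<omega>\<bar> powr p) \<le> b powr p"
        using \<open>p \<ge> 0\<close> by (auto intro!: powr_mono2)
    qed
  qed simp
  then show ?thesis using range by (simp add: Lp_lotteries_def)
qed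

text \<open>A common shift preserves every comparison. Equality is asked only on \<open>P\<close>,
  because only feasible points are compared.\<close>

lemma is_arg_max_add_const:
  fixes g :: "'a \<Rightarrow> 'b::linordered_ab_group_add"
  assumes "\<And>x. P x \<Longrightarrow> f x = g x + k"
  shows "is_arg_max f P x \<longleftrightarrow> is_arg_max g P x"
  using assms by (auto simp: is_arg_max_def)

theorem proposition8:
  fixes b L cbar p \<sigma> W0 \<gamma> :: real
    and M :: "'w measure" and E :: "'e measure" and \<epsilon> :: "'e \<Rightarrow> real"
    and K N S :: nat
    and W Y :: "nat \<Rightarrow> real pmf" and Z :: "nat \<Rightarrow> real"
    and y \<alpha> \<beta> c :: "nat \<Rightarrow> real"
    and \<xi> :: "nat \<Rightarrow> 'w \<Rightarrow> real"
    and u_MLE :: "real \<Rightarrow> real" and U_star :: "(real \<Rightarrow> real) set"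
  assumes "b > 0" and "L > 0" and "cbar > 0" and "p \<ge> 1" and "\<sigma> > 0"
    and "prob_space M"
    and "prob_space E" and "\<epsilon> \<in> borel_measurable E"
    and "\<forall>t. cdf (distr E borel \<epsilon>) t = exp (- exp (- t / \<sigma>))"
    and "\<forall>k\<in>{1..K}. finite (set_pmf (W k)) \<and> set_pmf (W k) \<subseteq> {0..b}"
    and "\<forall>k\<in>{1..K}. finite (set_pmf (Y k)) \<and> set_pmf (Y k) \<subseteq> {0..b}"
    and "\<forall>k\<in>{1..K}. Z k \<in> {1, - 1}"
    and "strict_mono_on {1..N} y"
    and "y ` {1..N} = {0, b} \<union> (\<Union>k\<in>{1..K}. set_pmf (W k) \<union> set_pmf (Y k))"
    and "is_arg_max (MLE_objective K W Y Z N y) (MLE_feasible L cbar N y) (\<alpha>, \<beta>, \<gamma>)"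
    and "\<gamma> > 0"
    and "u_MLE = MLE_utility N y \<alpha> \<gamma>"
    and "U_star = MLE_ambiguity_set b L N y u_MLE"
    and "W0 \<in> {0..b}" and "\<forall>s\<in>{1..S}. c s \<in> {0..1}"
    and "\<forall>s\<in>{0..S}. \<xi> s \<in> borel_measurable M"
    and "\<forall>\<omega>\<in>space M. \<xi> 0 \<omega> = 0"
    and "\<forall>x\<in>portfolios S W0 c. \<forall>\<omega>\<in>space M. wealth S \<xi> x \<omega> \<in> {0..b}"
  shows "(\<forall>\<delta>\<in>{0<..<1}. \<forall>X\<in>Lp_lotteries M p b.
            PRaR M E \<epsilon> U_star \<delta> X = PaR M E \<epsilon> u_MLE \<delta> X \<and>
            PaR M E \<epsilon> u_MLE \<delta> X = (\<integral>\<omega>. u_MLE (X \<omega>) \<partial>M) + inv (cdf (distr E borel \<epsilon>)) \<delta>) \<and>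
         (\<forall>\<delta>\<in>{0<..<1}.
            {x. is_arg_max (\<lambda>x. PRaR M E \<epsilon> U_star \<delta> (wealth S \<xi> x))
                  (\<lambda>x. x \<in> portfolios S W0 c) x} =
            {x. is_arg_max (\<lambda>x. \<integral>\<omega>. u_MLE (wealth S \<xi> x \<omega>) \<partial>M)
                  (\<lambda>x. x \<in> portfolios S W0 c) x})"
proof -
  have feas: "MLE_feasible L cbar N y (\<alpha>, \<beta>, \<gamma>)" using assms(15) by (simp add: is_arg_max_def)
  have nodes: "0 \<in> y ` {1..N}" "b \<in> y ` {1..N}" and range: "y ` {1..N} \<subseteq> {0..b}"
    using assms(1,10,11,14) by auto
  \<comment> \<open>The nodes include the distinct values 0 and \<open>b\<close>, so there are at
    least two of them.\<close>
  have N: "N \<ge> 2"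
  proof (rule ccontr)
    assume "\<not> N \<ge> 2"
    then have "\<And>i j. i \<in> {1..N} \<Longrightarrow> j \<in> {1..N} \<Longrightarrow> i = j" by auto
    with nodes \<open>b > 0\<close> show False by (metis imageE less_irrefl)
  qed
  have mono: "y k \<le> y l" if "k \<in> {1..N}" "l \<in> {1..N}" "k \<le> l" for k l
    using strict_mono_onD[OF assms(13), of k l] that by (cases "k = l") auto
  \<comment> \<open>The nodes are increasing, stay in \<open>{0..b}\<close> and include both
    endpoints, so the first and the last node are these endpoints.\<close>
  have ends: "y 1 = 0" "y N = b"
  proof -
    have "y 1 \<in> {0..b}" "y N \<in> {0..b}" using range N by (auto simp: image_subset_iff)
    moreover have "y 1 \<le> 0" "b \<le> y N" using nodes mono[of 1] mono[of _ N] N by fastforce+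
    ultimately show "y 1 = 0" "y N = b" by auto
  qed
  have in_U: "u_MLE \<in> U_star"
    using MLE_utility_in_ambiguity_set[OF feas \<open>\<gamma> > 0\<close> _ assms(13) N ends] assms(2,17,18) by simp
  have least: "(\<integral>\<omega>. u_MLE (X \<omega>) \<partial>M) \<le> (\<integral>\<omega>. u (X \<omega>) \<partial>M)"
    if u: "u \<in> U_star" and X: "X \<in> Lp_lotteries M p b" for u X
  proof (rule integral_mono)
    \<comment> \<open>Integrability matters for comparing the integrals: a non-integrable function
      has integral 0 by convention.\<close>
    show "integrable M (\<lambda>\<omega>. u_MLE (X \<omega>))" "integrable M (\<lambda>\<omega>. u (X \<omega>))"
      using in_U u assms(18)
      by (auto intro!: concave_utility_integrable[OF assms(6) _ X] simp: MLE_ambiguity_set_def)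
    show "u_MLE (X \<omega>) \<le> u (X \<omega>)" if "\<omega> \<in> space M" for \<omega>
      using MLE_utility_le[OF _ assms(13) N ends, of u L \<alpha> \<gamma> "X \<omega>"] u X that assms(17,18)
      by (auto simp: Lp_lotteries_def)
  qed
  let ?F = "cdf (distr E borel \<epsilon>)"
  have F: "?F = (\<lambda>t. exp (- exp (- t / \<sigma>)))" using assms(9) by auto
  have cont: "isCont ?F t" for t unfolding F using \<open>\<sigma> > 0\<close> by (intro continuous_intros) auto
  have smono: "strict_mono ?F" unfolding F by (rule strict_mono_gumbel[OF \<open>\<sigma> > 0\<close>])
  \<comment> \<open>\<open>inv\<close> chooses a preimage, which is meaningful at \<delta> only if
    one exists; the explicit Gumbel quantile supplies it.\<close>
  have inv: "?F (inv ?F \<delta>) = \<delta>" if "\<delta> \<in> {0<..<1}" for \<delta>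
  proof (rule f_inv_into_f)
    have "?F (- \<sigma> * ln (- ln \<delta>)) = \<delta>" unfolding F by (rule gumbel_quantile[OF \<open>\<sigma> > 0\<close> that])
    then show "\<delta> \<in> range ?F" by (metis rangeI)
  qed
  note value_eq = PRaR_eq[OF assms(7,8) cont smono inv]
  have star: "PRaR M E \<epsilon> U_star \<delta> X = (\<integral>\<omega>. u_MLE (X \<omega>) \<partial>M) + inv ?F \<delta>"
    if "\<delta> \<in> {0<..<1}" "X \<in> Lp_lotteries M p b" for \<delta> X
    using that in_U least by (intro value_eq) auto
  have single: "PaR M E \<epsilon> u_MLE \<delta> X = (\<integral>\<omega>. u_MLE (X \<omega>) \<partial>M) + inv ?F \<delta>"
    if "\<delta> \<in> {0<..<1}" for \<delta> X
    unfolding PaR_eq_PRaR_singleton using that by (intro value_eq) auto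
  have wealth: "wealth S \<xi> x \<in> Lp_lotteries M p b" if "x \<in> portfolios S W0 c" for x
    using wealth_in_Lp_lotteries[OF assms(6)] assms(4,21,23) that by simp
  \<comment> \<open>On feasible portfolios wealth is a lottery, so there the objectives differ by
    the constant \<open>inv ?F \<delta>\<close>.\<close>
  have "is_arg_max (\<lambda>x. PRaR M E \<epsilon> U_star \<delta> (wealth S \<xi> x)) (\<lambda>x. x \<in> portfolios S W0 c) x \<longleftrightarrow>
      is_arg_max (\<lambda>x. \<integral>\<omega>. u_MLE (wealth S \<xi> x \<omega>) \<partial>M) (\<lambda>x. x \<in> portfolios S W0 c) x"
    if "\<delta> \<in> {0<..<1}" for \<delta> x
    using star[OF that wealth] by (rule is_arg_max_add_const)
  then show ?thesis using star single by simp
qed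

end
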